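(* Let $(e_n)_{n\ge 0}$ be the sequence defined by $e_0=7$ and $e_n-e_{n-1}=11\cdot 2^{2n-1}$ for all $n\ge 1$. Then $e_n=\frac{1}{3}\left[11\cdot 2^{2n+1}-1\right]$ for all $n\ge 0$; for every odd number in the set $\{e_n : n\ge 0\}$, repeated application of the Collatz function $f$ eventually reaches $1$; and for each $n\ge 0$ the number of Collatz function operations needed to get $1$ from $e_n$ is $N_{e_n}=N_{11}+2n+2$.
   Context: The Collatz function $f:\mathbb{Z}_{\ge 1}\to\mathbb{Z}_{\ge 1}$ is defined by $f(n)=n/2$ if $n$ is even and $f(n)=3n+1$ if $n$ is odd. For a positive integer $k$, $N_k$ denotes the number of Collatz function operations for the number $k$ to get $1$, i.e. the least integer $m\ge 1$ such that the $m$-fold iterate satisfies $f^{m}(k)=1$ (so that $N_1=3$, via $1\to 4\to 2\to 1$), with $N_k=\infty$ if there is no such $m$. *)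

theory Defs
  imports Complex_Main "HOL-Library.Extended_Nat"
begin

text \<open>The Collatz function is meant for positive integers, which it maps to positive integers;
  its values on the remaining integers are irrelevant.\<close>

definition collatz :: "int \<Rightarrow> int" where
  "collatz n = (if even n then n div 2 else 3 * n + 1)"

text \<open>At least one step is required, so \<open>collatz_steps 1 = 3\<close> (via 1, 4, 2, 1) rather than 0.\<close>

definition collatz_steps :: "int \<Rightarrow> enat" where
  "collatz_steps k =
     (if \<exists>m\<ge>1. (collatz ^^ m) k = 1
      then enat (LEAST m. m \<ge> 1 \<and> (collatz ^^ m) k = 1)
      else \<infinity>)"

end

theory Submission imports Defs begin

text \<open>
  The recursion is built so that \<open>3 * e n + 1 = 11 * 2 ^ (2 * n + 1)\<close>: multiplying it by \<open>3\<close> turns the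
  increment \<open>11 * 2 ^ (2 * n - 1)\<close> into the difference of consecutive terms
  \<open>11 * 2 ^ (2 * n + 1) - 11 * 2 ^ (2 * n - 1)\<close>. This identity gives the closed form and also shows
  that every \<open>e n\<close> is odd. Hence the first Collatz operation takes \<open>e n\<close> to \<open>11 * 2 ^ (2 * n + 1)\<close>,
  and \<open>2 * n + 1\<close> halvings lead from there to \<open>11\<close>. The values passed on the way are multiples
  of \<open>11\<close>, hence different from \<open>1\<close>, so each of these \<open>2 * n + 2\<close> operations contributes exactly one to
  the count (\<open>collatz_steps_eSuc\<close>), and the orbit of \<open>11\<close> contributes the rest. Since \<open>11\<close> reaches
  \<open>1\<close>, so does every \<open>e n\<close>.
\<close>

lemma collatz_steps_neq_infinity_iff:
  "collatz_steps k \<noteq> \<infinity> \<longleftrightarrow> (\<exists>m\<ge>1. (collatz ^^ m) k = 1)"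
  by (simp add: collatz_steps_def)

text \<open>The hypothesis rules out \<open>k = 2\<close>, where the recursion fails: the count for \<open>2\<close> is \<open>1\<close>, but
  the count for \<open>1\<close> is \<open>3\<close>, because it ignores the zeroth iterate and goes once around the cycle.
  For any other \<open>k\<close>, the positive times at which \<open>k\<close> reaches \<open>1\<close> are those of \<open>collatz k\<close>, delayed
  by one.\<close>

lemma collatz_steps_eSuc:
  assumes "collatz k \<noteq> 1"
  shows "collatz_steps k = eSuc (collatz_steps (collatz k))"
proof -
  define P where "P x m \<longleftrightarrow> m \<ge> 1 \<and> (collatz ^^ m) x = 1" for x m
  have steps: "collatz_steps x = (if \<exists>m. P x m then enat (LEAST m. P x m) else \<infinity>)" for x
    by (simp add: collatz_steps_def P_def)
  have shift: "P k (Suc m) \<longleftrightarrow> P (collatz k) m" for m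
    using assms by (cases m) (simp_all add: P_def funpow_Suc_right del: funpow.simps(2))
  have not0: "\<not> P x 0" for x
    by (simp add: P_def)
  have ex: "(\<exists>m. P k m) \<longleftrightarrow> (\<exists>m. P (collatz k) m)"
    by (metis shift not0 not0_implies_Suc)
  show ?thesis
  proof (cases "\<exists>m. P k m")
    case True
    then obtain m where "P k m" ..
    then have "(LEAST m. P k m) = Suc (LEAST m. P k (Suc m))"
      using not0 by (rule Least_Suc)
    with True ex show ?thesis
      by (simp add: steps shift eSuc_enat)
  next
    case False
    with ex show ?thesis
      by (simp add: steps)
  qed
qed

lemma collatz_steps_mult_power_of_2:
  assumes "a > 1"
  shows "collatz_steps (a * 2 ^ m) = collatz_steps a + enat m"
proof (induction m)
  case 0
  show ?case
    by (simp flip: zero_enat_def)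
next
  case (Suc m)
  have halve: "collatz (a * 2 ^ Suc m) = a * 2 ^ m"
    by (simp add: collatz_def)
  have "a \<le> a * 2 ^ m"
    using assms mult_left_mono[of 1 "2 ^ m" a] by simp
  with assms have "a * 2 ^ m \<noteq> 1"
    by linarith
  then have "collatz_steps (a * 2 ^ Suc m) = eSuc (collatz_steps (a * 2 ^ m))"
    using collatz_steps_eSuc[of "a * 2 ^ Suc m"] halve by metis
  also have "\<dots> = collatz_steps a + enat (Suc m)"
    by (simp add: Suc iadd_Suc_right flip: eSuc_enat)
  finally show ?case .
qed

lemma collatz_steps_11_finite: "collatz_steps 11 \<noteq> \<infinity>"
proof -
  (* 11, 34, 17, 52, 26, 13, 40, 20, 10, 5, 16, 8, 4, 2, 1 *)
  have "(collatz ^^ 14) 11 = 1"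
    by (simp add: numeral_eq_Suc collatz_def)
  then show ?thesis
    unfolding collatz_steps_neq_infinity_iff by (intro exI[of _ 14]) simp
qed

theorem theorem5:
  fixes e :: "nat \<Rightarrow> int"
  assumes "e 0 = 7"
    and "\<And>n. n \<ge> 1 \<Longrightarrow> e n - e (n - 1) = 11 * 2 ^ (2 * n - 1)"
  shows "(\<forall>n. real_of_int (e n) = 1 / 3 * (11 * 2 ^ (2 * n + 1) - 1)) \<and>
    (\<forall>x \<in> range e. odd x \<longrightarrow> (\<exists>m\<ge>1. (collatz ^^ m) x = 1)) \<and>
    (\<forall>n. collatz_steps (e n) = collatz_steps 11 + enat (2 * n + 2))"
proof -
  have triple: "3 * e n + 1 = 11 * 2 ^ (2 * n + 1)" for n
  proof (induction n)
    case 0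
    show ?case
      by (simp add: assms(1))
  next
    case (Suc n)
    have "e (Suc n) = e n + 11 * 2 ^ (2 * n + 1)"
      using assms(2)[of "Suc n"] by simp
    with Suc show ?case
      by simp
  qed
  have closed_form: "real_of_int (e n) = 1 / 3 * (11 * 2 ^ (2 * n + 1) - 1)" for n
  proof -
    have "real_of_int (3 * e n + 1) = real_of_int (11 * 2 ^ (2 * n + 1))"
      using triple by (rule arg_cong)
    then show ?thesis
      by simp
  qed
  have count: "collatz_steps (e n) = collatz_steps 11 + enat (2 * n + 2)" for n
  proof -
    have "even (3 * e n + 1)"
      unfolding triple by simp
    then have "odd (e n)"
      by simp
    then have "collatz (e n) = 11 * 2 ^ (2 * n + 1)"
      using triple[of n] by (simp add: collatz_def)
    moreover have "11 * 2 ^ (2 * n + 1) \<noteq> (1 :: int)"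
      by presburger
    ultimately have "collatz_steps (e n) = eSuc (collatz_steps (11 * 2 ^ (2 * n + 1)))"
      using collatz_steps_eSuc[of "e n"] by metis
    also have "\<dots> = eSuc (collatz_steps 11 + enat (2 * n + 1))"
      by (subst collatz_steps_mult_power_of_2) simp_all
    also have "\<dots> = collatz_steps 11 + enat (2 * n + 2)"
      by (simp add: eSuc_enat flip: iadd_Suc_right)
    finally show ?thesis .
  qed
  have "\<exists>m\<ge>1. (collatz ^^ m) (e n) = 1" for n
    unfolding collatz_steps_neq_infinity_iff[symmetric] count
    using collatz_steps_11_finite by (simp add: plus_eq_infty_iff_enat)
  with closed_form count show ?thesis
    by blast
qed

end
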